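(* Let $X$ be a complex Banach space and $T\in\mathcal{B}(X)$. Then the following statements are equivalent: (i) There exist an operator $S_2\in\mathcal{B}(X)$ and an integer $j\ge 0$ such that $TS_2T=T^2S_2$, $TS_2^2=S_2$, $T^{j+1}S_2=T^j$. (ii) There exists a projection $P\in\mathcal{B}(X)$ such that $TP=PT$, $T+P$ is right invertible and $TP$ is nilpotent (i.e. $(TP)^j=0$ for some integer $j\ge 1$). (iii) $j:=\mathrm{dsc}(T)<\infty$, and the subspace $\mathcal{R}(T^j)\cap\mathcal{N}(T)$ is topologically complemented in $X$. (iv) There exist an integer $j\ge 0$ and a closed subspace $N$ such that $X=\mathcal{R}(T^j)\oplus N$, $T|_{\mathcal{R}(T^j)}$ is right invertible and $(T|_N)^j=0$, where $\mathcal{R}(T^j)$ and $N$ reduce $T$ (in particular $\mathcal{R}(T^j)$ is closed). (v) There exist closed subspaces $M,N$ reducing $T$, so that $T=T|_M\oplus T|_N$, where $T|_M$ is right invertible and $T|_N$ is nilpotent. (vi) There exists an integer $j\ge 0$ such that $\mathcal{R}(T^j)$ is topologically complemented in $X$ and the operator $T:\mathcal{R}(T^j)\to\mathcal{R}(T^j)$ induced by $T$ is right invertible.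
   Context: $\mathcal{B}(X)$ is the algebra of bounded linear operators on $X$; $\mathcal{N}(T)$ and $\mathcal{R}(T)$ are the null space and range of $T$; $T^0=I$. A projection is an idempotent in $\mathcal{B}(X)$. An operator $A\in\mathcal{B}(Y)$ is right invertible if there is $B\in\mathcal{B}(Y)$ with $AB=I$. The descent $\mathrm{dsc}(T)$ is the smallest integer $q\ge 0$ with $\mathcal{R}(T^q)=\mathcal{R}(T^{q+1})$ ($\infty$ if none exists). Closed subspaces $M,N$ of $X$ reduce $T$ if $X=M\oplus N$ and both are invariant under $T$; then $T|_M\in\mathcal{B}(M)$, $T|_N\in\mathcal{B}(N)$ are the restrictions. A subspace is topologically complemented if it is closed and has a closed complement. *)

theory Defs
  imports "HOL-Analysis.Analysis" "HOL-Library.Extended_Nat"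
begin

class complex_banach = banach +
  fixes scaleC :: "complex \<Rightarrow> 'a \<Rightarrow> 'a"  (infixr \<open>*C\<close> 75)
  assumes scaleC_add_right: "c *C (x + y) = c *C x + c *C y"
    and scaleC_add_left: "(c + d) *C x = c *C x + d *C x"
    and scaleC_scaleC: "c *C (d *C x) = (c * d) *C x"
    and scaleC_of_real: "complex_of_real r *C x = r *\<^sub>R x"
    and norm_scaleC: "norm (c *C x) = cmod c * norm x"

global_interpretation complex_vector:
  vector_space "scaleC :: complex \<Rightarrow> 'a \<Rightarrow> 'a::complex_banach"
proof
  show "1 *C x = x" for x :: 'a
    using scaleC_of_real[of 1 x] by simp
qed (simp_all add: scaleC_add_right scaleC_add_left scaleC_scaleC)

instantiation complex :: complex_banach
begin

definition "scaleC c (x::complex) = c * x"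

instance
  by standard (simp_all add: scaleC_complex_def algebra_simps norm_mult scaleR_conv_of_real)

end

text \<open>
  The elements of \<open>bounded_ops M\<close> represent the algebra of bounded complex-linear operators on the
  subspace \<open>M\<close>.  Operators are functions on the whole type of which only the values on \<open>M\<close> matter,
  so the restriction of \<open>T\<close> to an invariant subspace \<open>M\<close> is represented by \<open>T\<close> itself, viewed on \<open>M\<close>,
  and equations between operators on \<open>M\<close> are to be read pointwise on \<open>M\<close>.
\<close>

definition bounded_ops :: "'a::complex_banach set \<Rightarrow> ('a \<Rightarrow> 'a) set" where
  "bounded_ops M = {A. A ` M \<subseteq> M
      \<and> (\<forall>x\<in>M. \<forall>y\<in>M. A (x + y) = A x + A y)
      \<and> (\<forall>c. \<forall>x\<in>M. A (c *C x) = c *C A x)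
      \<and> (\<exists>K. \<forall>x\<in>M. norm (A x) \<le> norm x * K)}"

lemma bounded_ops_UNIV_iff:
  "A \<in> bounded_ops UNIV \<longleftrightarrow> bounded_linear A \<and> (\<forall>c x. A (c *C x) = c *C A x)"
proof
  assume A: "A \<in> bounded_ops UNIV"
  then have "A (r *\<^sub>R x) = r *\<^sub>R A x" for r x
    unfolding scaleC_of_real[symmetric] by (simp add: bounded_ops_def)
  with A show "bounded_linear A \<and> (\<forall>c x. A (c *C x) = c *C A x)"
    by (auto simp: bounded_ops_def intro: bounded_linear_intro)
next
  assume "bounded_linear A \<and> (\<forall>c x. A (c *C x) = c *C A x)"
  then show "A \<in> bounded_ops UNIV"
    using bounded_linear.bounded[of A]
    by (auto simp: bounded_ops_def linear_simps)
qed

definition right_invertible_on :: "'a::complex_banach set \<Rightarrow> ('a \<Rightarrow> 'a) \<Rightarrow> bool" where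
  "right_invertible_on M A \<longleftrightarrow>
     A \<in> bounded_ops M \<and> (\<exists>B\<in>bounded_ops M. \<forall>x\<in>M. A (B x) = x)"

definition nilpotent_on :: "'a::complex_banach set \<Rightarrow> ('a \<Rightarrow> 'a) \<Rightarrow> bool" where
  "nilpotent_on M A \<longleftrightarrow> A \<in> bounded_ops M \<and> (\<exists>n\<ge>1. \<forall>x\<in>M. (A ^^ n) x = 0)"

definition projection :: "('a::complex_banach \<Rightarrow> 'a) \<Rightarrow> bool" where
  "projection P \<longleftrightarrow> P \<in> bounded_ops UNIV \<and> P \<circ> P = P"

definition null_space :: "('a::complex_banach \<Rightarrow> 'a) \<Rightarrow> 'a set" where
  "null_space T = {x. T x = 0}"

definition closed_csubspace :: "'a::complex_banach set \<Rightarrow> bool" where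
  "closed_csubspace M \<longleftrightarrow> complex_vector.subspace M \<and> closed M"

definition direct_sum :: "'a::complex_banach set \<Rightarrow> 'a set \<Rightarrow> bool" where
  "direct_sum M N \<longleftrightarrow> {x + y |x y. x \<in> M \<and> y \<in> N} = UNIV \<and> M \<inter> N = {0}"

definition topologically_complemented :: "'a::complex_banach set \<Rightarrow> bool" where
  "topologically_complemented M \<longleftrightarrow>
     closed_csubspace M \<and> (\<exists>N. closed_csubspace N \<and> direct_sum M N)"

definition reduce :: "'a::complex_banach set \<Rightarrow> 'a set \<Rightarrow> ('a \<Rightarrow> 'a) \<Rightarrow> bool" where
  "reduce M N T \<longleftrightarrow> closed_csubspace M \<and> closed_csubspace N \<and> direct_sum M N
     \<and> T ` M \<subseteq> M \<and> T ` N \<subseteq> N"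

text \<open>The infimum of the empty set in \<^typ>\<open>enat\<close> is \<open>\<infinity>\<close>.\<close>

definition descent :: "('a::complex_banach \<Rightarrow> 'a) \<Rightarrow> enat" where
  "descent T = Inf {enat q |q. range (T ^^ q) = range (T ^^ (q + 1))}"

definition all_equivalent :: "bool list \<Rightarrow> bool" where
  "all_equivalent ps \<longleftrightarrow> (\<forall>p\<in>set ps. \<forall>q\<in>set ps. p \<longleftrightarrow> q)"

end

theory Submission
  imports Defs
begin

text \<open>
  Conditions (i), (ii), (iv), (v) all amount to a projection commuting with \<open>T\<close>, onto a subspace
  \<open>M\<close> on which \<open>T\<close> is right invertible and along one on which \<open>T\<close> is nilpotent; for (i) it is
  \<open>T S\<close>, for (ii) it is \<open>I - P\<close>.  The substance lies in deriving it from (iii), where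
  \<open>R = R(T\<^sup>j)\<close> is not known to be closed.  Let \<open>Q\<close> be a bounded projection onto \<open>R \<inter> N(T)\<close>, and for
  \<open>y \<in> R\<close> let \<open>V y\<close> be the unique \<open>v \<in> R\<close> with \<open>T v = y\<close> and \<open>Q v = 0\<close>, so that \<open>V T = I - Q\<close> on \<open>R\<close>.
  Although \<open>V\<close> need not be continuous a priori, \<open>V A\<close> is bounded for every bounded \<open>A\<close> with range in
  \<open>R\<close>: its value at \<open>x\<close> is \<open>T\<^sup>j u\<close> for any \<open>u\<close> in the closed linear relation \<open>Q T\<^sup>j u = 0\<close>,
  \<open>T\<^sup>j\<^sup>+\<^sup>1 u = A x\<close>, and a closed linear relation with full domain has a bounded selection.  Hence
  \<open>P = (\<Sum>i<j. V\<^sup>i Q T\<^sup>i) + V\<^sup>j T\<^sup>j\<close> is bounded; it is the identity on \<open>R\<close>, has range \<open>R\<close> and commutes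
  with \<open>T\<close>, and \<open>T\<^sup>j\<close> vanishes on its kernel.
\<close>

section \<open>Closed linear relations with full domain\<close>

text \<open>The open mapping argument for relations: Baire's theorem yields approximate solutions
  with controlled \<open>y\<close>. Correcting the residual repeatedly gives a convergent series,
  and closedness of \<open>H\<close> keeps its limit in the relation.\<close>

lemma closed_linear_relation_bounded_selection:
  fixes H :: "('a::banach \<times> 'b::banach) set"
  assumes "closed H" "subspace H" and total: "\<And>x. \<exists>y. (x, y) \<in> H"
  obtains C where "C \<ge> 0" "\<And>x. \<exists>y. (x, y) \<in> H \<and> norm y \<le> C * norm x"
proof -
  define F where "F n = {x. \<exists>y. (x, y) \<in> H \<and> norm y \<le> real n}" for n :: nat
  have F_cover: "(\<Union>n. closure (F n)) = UNIV"
  proof -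
    have "x \<in> (\<Union>n. closure (F n))" for x
    proof -
      obtain y where "(x, y) \<in> H" using total by blast
      moreover obtain n :: nat where "norm y \<le> real n" using real_arch_simple by blast
      ultimately have "x \<in> F n" by (auto simp: F_def)
      then show ?thesis using closure_subset by blast
    qed
    then show ?thesis by blast
  qed
  have "\<exists>n. interior (closure (F n)) \<noteq> {}"
  proof (rule ccontr)
    assume "\<not> ?thesis"
    then have "euclidean interior_of (\<Union>(range (\<lambda>n. closure (F n)))) = {}"
      by (intro Baire_category_alt disjI1 completely_metrizable_space_euclidean)
        auto
    then show False using F_cover by simp
  qed
  then obtain n x0 r where r: "r > 0" "ball x0 r \<subseteq> closure (F n)"
    by (metis all_not_in_conv mem_interior)
  \<comment> \<open>The ball is moved from \<open>x0\<close> to the origin: \<open>z\<close> is half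
    the difference of \<open>x0 + z\<close> and \<open>x0 - z\<close>, and halving keeps the bound
    \<open>n\<close> on the second component.\<close>
  have approx: "\<exists>x y. (x, y) \<in> H \<and> norm y \<le> real n \<and> norm (z - x) < e"
    if "norm z < r" "e > 0" for z e
  proof -
    have "x0 + z \<in> closure (F n)" "x0 - z \<in> closure (F n)"
      using r that by (auto simp: subset_iff dist_norm)
    with \<open>e > 0\<close> obtain x1 y1 x2 y2 where 1: "(x1, y1) \<in> H" "norm y1 \<le> n" "dist x1 (x0 + z) < e"
      and 2: "(x2, y2) \<in> H" "norm y2 \<le> n" "dist x2 (x0 - z) < e"
      unfolding closure_approachable F_def by blast
    have "(1/2) *\<^sub>R ((x1, y1) - (x2, y2)) \<in> H"
      using 1 2 assms(2) by (intro subspace_scale subspace_diff)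
    moreover have "norm ((1/2) *\<^sub>R (y1 - y2)) \<le> n"
      using norm_triangle_ineq4[of y1 y2] 1 2 by simp
    moreover have "norm (z - (1/2) *\<^sub>R (x1 - x2)) < e"
    proof -
      have "z - (1/2) *\<^sub>R (x1 - x2) = (1/2) *\<^sub>R ((x2 - (x0 - z)) - (x1 - (x0 + z)))"
        by (simp add: algebra_simps flip: scaleR_add_left)
      also have "norm \<dots> < e"
        using norm_triangle_ineq4[of "x2 - (x0 - z)" "x1 - (x0 + z)"] 1 2 by (simp add: dist_norm)
      finally show ?thesis .
    qed
    ultimately show ?thesis by (metis diff_Pair scaleR_Pair)
  qed
  define C where "C = 2 * real n / r"
  have C: "C \<ge> 0" using r by (simp add: C_def)
  have "\<exists>x' y. (x', y) \<in> H \<and> norm (x - x') \<le> norm x / 2 \<and> norm y \<le> C * norm x" for x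
  proof (cases "x = 0")
    case True
    then show ?thesis using subspace_0[OF assms(2)] by (intro exI[of _ 0]) (simp add: zero_prod_def)
  next
    case False
    \<comment> \<open>Division by \<open>t\<close> brings \<open>x\<close> to norm
      \<open>r/2\<close>, inside the ball; an error below \<open>r/4\<close> scales back to at most
      \<open>norm x / 2\<close>.\<close>
    define t where "t = 2 * norm x / r"
    have t: "t > 0" using False r by (simp add: t_def)
    have "norm ((1/t) *\<^sub>R x) < r" using False r by (simp add: t_def)
    then obtain x' y where xy: "(x', y) \<in> H" "norm y \<le> n" "norm ((1/t) *\<^sub>R x - x') < r/4"
      using approx[of "(1/t) *\<^sub>R x" "r/4"] r by auto
    have "norm (x - t *\<^sub>R x') = t * norm ((1/t) *\<^sub>R x - x')"
    proof -
      have "x - t *\<^sub>R x' = t *\<^sub>R ((1/t) *\<^sub>R x - x')" using t by (simp add: scaleR_diff_right)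
      then show ?thesis using t by simp
    qed
    also have "\<dots> \<le> t * (r/4)" using t xy by (intro mult_left_mono) auto
    also have "\<dots> = norm x / 2" using r by (simp add: t_def)
    finally have "norm (x - t *\<^sub>R x') \<le> norm x / 2" .
    moreover have "norm (t *\<^sub>R y) \<le> C * norm x"
    proof -
      have "norm (t *\<^sub>R y) \<le> t * n" using t xy by simp
      then show ?thesis by (simp add: t_def C_def mult_ac)
    qed
    moreover have "(t *\<^sub>R x', t *\<^sub>R y) \<in> H"
      using subspace_scale[OF assms(2) xy(1), of t] by simp
    ultimately show ?thesis by blast
  qed
  then obtain f g where fg: "\<And>x. (f x, g x) \<in> H" "\<And>x. norm (x - f x) \<le> norm x / 2"
    "\<And>x. norm (g x) \<le> C * norm x"
    by metis
  have "\<exists>y. (x, y) \<in> H \<and> norm y \<le> (2 * C) * norm x" for x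
  proof -
    \<comment> \<open>\<open>u k\<close> is the residual after \<open>k\<close> corrections. Its
      norm halves at every step, and \<open>x - u m\<close> telescopes to the sum of
      \<open>f (u k)\<close> over \<open>k < m\<close>, whose partners are the
      \<open>g (u k)\<close>.\<close>
    define u where "u k = ((\<lambda>x. x - f x) ^^ k) x" for k
    have u_Suc: "u (Suc k) = u k - f (u k)" for k by (simp add: u_def)
    have u_le: "norm (u k) \<le> norm x * (1/2) ^ k" for k
    proof (induction k)
      case (Suc k)
      then show ?case using fg(2)[of "u k"] by (simp add: u_Suc)
    qed (simp add: u_def)
    have g_le: "norm (g (u k)) \<le> C * norm x * (1/2) ^ k" for k
      using fg(3)[of "u k"] mult_left_mono[OF u_le C, of k] by (simp add: mult.assoc)
    have sums: "(\<lambda>k. C * norm x * (1/2) ^ k) sums (C * norm x * 2)"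
      using sums_mult[OF geometric_sums[of "1/2 :: real"], of "C * norm x"] by simp
    have summ: "summable (\<lambda>k. g (u k))"
      by (rule summable_comparison_test'[OF sums_summable[OF sums]]) (use g_le in auto)
    have "norm (\<Sum>k. g (u k)) \<le> (\<Sum>k. C * norm x * (1/2) ^ k)"
      by (rule norm_suminf_le[OF g_le sums_summable[OF sums]])
    then have le: "norm (\<Sum>k. g (u k)) \<le> 2 * C * norm x"
      using sums_unique[OF sums] by simp
    have "(x - u m, \<Sum>k<m. g (u k)) \<in> H" for m
    proof (induction m)
      case 0
      then show ?case using subspace_0[OF assms(2)] by (simp add: u_def zero_prod_def)
    next
      case (Suc m)
      then show ?case
        using subspace_add[OF assms(2) Suc fg(1)[of "u m"]] by (simp add: u_Suc algebra_simps)
    qed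
    moreover have "(\<lambda>m. (x - u m, \<Sum>k<m. g (u k))) \<longlonglongrightarrow> (x - 0, \<Sum>k. g (u k))"
    proof (intro tendsto_Pair tendsto_diff tendsto_const)
      show "u \<longlonglongrightarrow> 0"
        by (rule Lim_null_comparison[of _ "\<lambda>k. norm x * (1/2) ^ k"])
          (use u_le in \<open>auto intro!: tendsto_mult_right_zero LIMSEQ_power_zero\<close>)
      show "(\<lambda>m. \<Sum>k<m. g (u k)) \<longlonglongrightarrow> (\<Sum>k. g (u k))"
        using summ by (rule summable_LIMSEQ)
    qed
    ultimately have "(x - 0, \<Sum>k. g (u k)) \<in> H"
      by (rule closed_sequentially[OF assms(1)])
    then show ?thesis using le by auto
  qed
  with C show ?thesis by (intro that[of "2 * C"]) auto
qed

lemma scaleR_eq_scaleC: "r *\<^sub>R x = complex_of_real r *C x"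
  by (simp add: scaleC_of_real)

text \<open>A closed graph theorem for a relation that need not be single-valued: only
  \<open>f y\<close> has to be determined by \<open>x\<close>. Linearity comes from the relation,
  and a bounded selection gives the norm bound.\<close>

lemma bounded_ops_of_closed_relation:
  fixes A f :: "'a::complex_banach \<Rightarrow> 'a"
  assumes H: "closed H"
    and add: "\<And>x y x' y'. (x, y) \<in> H \<Longrightarrow> (x', y') \<in> H \<Longrightarrow> (x + x', y + y') \<in> H"
    and scale: "\<And>c x y. (x, y) \<in> H \<Longrightarrow> (c *C x, c *C y) \<in> H"
    and total: "\<And>x. \<exists>y. (x, y) \<in> H"
    and f: "f \<in> bounded_ops UNIV" and A: "\<And>x y. (x, y) \<in> H \<Longrightarrow> A x = f y"
  shows "A \<in> bounded_ops UNIV"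
proof -
  have "subspace H"
  proof (rule subspaceI)
    obtain y where "(0, y) \<in> H" using total by blast
    from scale[OF this, of 0] show "0 \<in> H" by (simp add: zero_prod_def)
    show "p + q \<in> H" if "p \<in> H" "q \<in> H" for p q
      using add[of "fst p" "snd p" "fst q" "snd q"] that by (simp add: plus_prod_def)
    show "r *\<^sub>R p \<in> H" if "p \<in> H" for r p
      using scale[of "fst p" "snd p"] that by (simp add: scaleR_prod_def scaleR_eq_scaleC)
  qed
  then obtain C where C: "C \<ge> 0" "\<And>x. \<exists>y. (x, y) \<in> H \<and> norm y \<le> C * norm x"
    using closed_linear_relation_bounded_selection[OF H _ total] by metis
  obtain K where K: "\<And>x. norm (f x) \<le> norm x * K" and "K > 0"
    using f bounded_linear.pos_bounded unfolding bounded_ops_UNIV_iff by metis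
  have "A (x + y) = A x + A y" for x y
  proof -
    obtain u v where "(x, u) \<in> H" "(y, v) \<in> H" using total by meson
    then have "A (x + y) = f (u + v)" "A x = f u" "A y = f v" using A add by blast+
    then show ?thesis using f by (simp add: bounded_ops_def)
  qed
  moreover have "A (c *C x) = c *C A x" for c x
  proof -
    obtain u where "(x, u) \<in> H" using total by meson
    then have "A (c *C x) = f (c *C u)" "A x = f u" using A scale by blast+
    then show ?thesis using f by (simp add: bounded_ops_def)
  qed
  moreover have "norm (A x) \<le> norm x * (C * K)" for x
  proof -
    obtain u where u: "(x, u) \<in> H" "norm u \<le> C * norm x" using C by blast
    have "norm (A x) \<le> norm u * K" using A[OF u(1)] K by simp
    also have "\<dots> \<le> (C * norm x) * K" using u \<open>K > 0\<close> by (intro mult_right_mono) auto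
    finally show ?thesis by (simp add: mult_ac)
  qed
  ultimately show ?thesis by (auto simp: bounded_ops_def)
qed

section \<open>Algebra of bounded operators and closed subspaces\<close>

lemma bounded_opsD:
  assumes "A \<in> bounded_ops UNIV"
  shows "bounded_linear A" "A (x + y) = A x + A y" "A (x - y) = A x - A y" "A (- x) = - A x"
    "A 0 = 0" "A (c *C x) = c *C A x"
proof -
  from assms have bl: "bounded_linear A" and sc: "A (c *C x) = c *C A x"
    by (auto simp: bounded_ops_UNIV_iff)
  show "bounded_linear A" "A (x + y) = A x + A y" "A (x - y) = A x - A y" "A (- x) = - A x"
    "A 0 = 0" "A (c *C x) = c *C A x"
    using bl sc by (simp_all add: linear_simps)
qed

lemma bounded_ops_id: "(\<lambda>x. x) \<in> bounded_ops UNIV"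
  by (auto simp: bounded_ops_def intro!: exI[of _ 1])

lemma bounded_ops_zero: "(\<lambda>x. 0) \<in> bounded_ops UNIV"
  by (auto simp: bounded_ops_def intro: exI[of _ 0])

lemma bounded_ops_comp:
  "A \<in> bounded_ops UNIV \<Longrightarrow> B \<in> bounded_ops UNIV \<Longrightarrow> (\<lambda>x. A (B x)) \<in> bounded_ops UNIV"
  by (auto simp: bounded_ops_UNIV_iff intro: bounded_linear_compose)

lemma bounded_ops_add:
  "A \<in> bounded_ops UNIV \<Longrightarrow> B \<in> bounded_ops UNIV \<Longrightarrow> (\<lambda>x. A x + B x) \<in> bounded_ops UNIV"
  by (auto simp: bounded_ops_UNIV_iff complex_vector.scale_right_distrib intro: bounded_linear_add)

lemma bounded_ops_diff:
  "A \<in> bounded_ops UNIV \<Longrightarrow> B \<in> bounded_ops UNIV \<Longrightarrow> (\<lambda>x. A x - B x) \<in> bounded_ops UNIV"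
  by (auto simp: bounded_ops_UNIV_iff complex_vector.scale_right_diff_distrib
      intro: bounded_linear_sub)

lemma bounded_ops_funpow:
  assumes "A \<in> bounded_ops UNIV" shows "A ^^ n \<in> bounded_ops UNIV"
proof (induction n)
  case 0
  then show ?case using bounded_ops_id by (simp add: id_def)
next
  case (Suc n)
  then show ?case using bounded_ops_comp[OF assms] by (simp add: comp_def)
qed

lemma bounded_ops_restrict:
  assumes "A \<in> bounded_ops UNIV" "A ` M \<subseteq> M"
  shows "A \<in> bounded_ops M"
  using assms by (auto simp: bounded_ops_def)

lemma bounded_ops_comp_on:
  assumes "B \<in> bounded_ops M" "A \<in> bounded_ops UNIV" "range A \<subseteq> M"
  shows "(\<lambda>x. B (A x)) \<in> bounded_ops UNIV"
proof -
  obtain K where K: "\<And>x. x \<in> M \<Longrightarrow> norm (B x) \<le> norm x * K"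
    using assms(1) unfolding bounded_ops_def by blast
  obtain L where L: "\<And>x. norm (A x) \<le> norm x * L"
    using assms(2) unfolding bounded_ops_def by blast
  have AM: "A x \<in> M" for x using assms(3) by blast
  have "norm (B (A x)) \<le> norm x * (L * \<bar>K\<bar>)" for x
  proof -
    have "norm (B (A x)) \<le> norm (A x) * K" using K AM by blast
    \<comment> \<open>The bound \<open>K\<close> may be negative when \<open>M\<close> is
      trivial.\<close>
    also have "\<dots> \<le> norm (A x) * \<bar>K\<bar>" by (intro mult_left_mono) auto
    also have "\<dots> \<le> (norm x * L) * \<bar>K\<bar>" by (intro mult_right_mono L) auto
    finally show ?thesis by (simp add: mult_ac)
  qed
  moreover have "B (A (x + y)) = B (A x) + B (A y)" for x y
    using assms(1,2) AM by (simp add: bounded_ops_def)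
  moreover have "B (A (c *C x)) = c *C B (A x)" for c x
    using assms(1,2) AM by (simp add: bounded_ops_def)
  ultimately show ?thesis by (auto simp: bounded_ops_def)
qed

lemma closed_csubspace_eq_set:
  assumes "A \<in> bounded_ops UNIV" "B \<in> bounded_ops UNIV"
  shows "closed_csubspace {x. A x = B x}"
proof -
  note A = bounded_opsD[OF assms(1)] and B = bounded_opsD[OF assms(2)]
  have "closed {x. A x = B x}"
    by (intro closed_Collect_eq linear_continuous_on A B)
  then show ?thesis
    by (auto simp: closed_csubspace_def A B intro!: complex_vector.subspaceI)
qed

lemma csubspace_range:
  assumes "A \<in> bounded_ops UNIV"
  shows "complex_vector.subspace (range A)"
proof (rule complex_vector.subspaceI)
  note A = bounded_opsD[OF assms]
  show "0 \<in> range A" using A(5) rangeI[of A 0] by simp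
  show "x + y \<in> range A" if "x \<in> range A" "y \<in> range A" for x y
    using that by (auto simp: A(2)[symmetric])
  show "c *C x \<in> range A" if "x \<in> range A" for c x
    using that by (auto simp: A(6)[symmetric])
qed

section \<open>Projections and topological complements\<close>

text \<open>Boundedness is the closed graph theorem: the graph of the projection consists of the
  pairs \<open>(x, y)\<close> with \<open>y\<close> in \<open>M\<close> and \<open>x - y\<close> in
  \<open>N\<close>, both closed conditions.\<close>

lemma projection_of_direct_sum:
  assumes "closed_csubspace M" "closed_csubspace N" "direct_sum M N"
  obtains P where "P \<in> bounded_ops UNIV" "\<And>x. P x \<in> M" "\<And>x. x - P x \<in> N"
    "\<And>x. x \<in> M \<Longrightarrow> P x = x" "\<And>x. x \<in> N \<Longrightarrow> P x = 0"
proof -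
  have cM: "closed M" and cN: "closed N" and
    sM: "complex_vector.subspace M" and sN: "complex_vector.subspace N"
    using assms by (auto simp: closed_csubspace_def)
  note sub = complex_vector.subspace_add complex_vector.subspace_diff complex_vector.subspace_scale
  have uniq: "y = z" if "y \<in> M" "x - y \<in> N" "z \<in> M" "x - z \<in> N" for x y z
  proof -
    have "y - z \<in> M" using that sub(2)[OF sM] by blast
    moreover have "(x - z) - (x - y) \<in> N" using that sub(2)[OF sN] by blast
    ultimately have "y - z \<in> M \<inter> N" by simp
    then have "y - z = 0" using assms(3) unfolding direct_sum_def by blast
    then show ?thesis by simp
  qed
  have ex: "\<exists>y. y \<in> M \<and> x - y \<in> N" for x
  proof -
    have "x \<in> {x + y |x y. x \<in> M \<and> y \<in> N}" using assms(3) by (auto simp: direct_sum_def)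
    then show ?thesis by force
  qed
  then obtain P where P: "\<And>x. P x \<in> M" "\<And>x. x - P x \<in> N" by metis
  have "P \<in> bounded_ops UNIV"
  proof (rule bounded_ops_of_closed_relation)
    let ?H = "snd -` M \<inter> (\<lambda>p. fst p - snd p) -` N"
    show "closed ?H"
      by (intro closed_Int closed_vimage_snd closed_vimage cM cN continuous_intros)
    show "(x + x', y + y') \<in> ?H" if "(x, y) \<in> ?H" "(x', y') \<in> ?H" for x x' y y'
      using that sub(1)[OF sM, of y y'] sub(1)[OF sN, of "x - y" "x' - y'"]
      by (simp add: algebra_simps)
    show "(c *C x, c *C y) \<in> ?H" if "(x, y) \<in> ?H" for x y c
      using that sub(3)[OF sM, of y] sub(3)[OF sN, of "x - y"]
      by (simp add: complex_vector.scale_right_diff_distrib)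
    show "\<exists>y. (x, y) \<in> ?H" for x using ex by simp
    show "(\<lambda>x. x) \<in> bounded_ops UNIV" by (rule bounded_ops_id)
    show "P x = y" if "(x, y) \<in> ?H" for x y using that uniq[OF P] by simp
  qed
  moreover have "P x = x" if "x \<in> M" for x
    using uniq[OF P(1) P(2) that] complex_vector.subspace_0[OF sN] by simp
  moreover have "P x = 0" if "x \<in> N" for x
    using uniq[OF P(1) P(2)] complex_vector.subspace_0[OF sM] that by simp
  ultimately show ?thesis using P that by blast
qed

lemma direct_sum_of_projection:
  assumes P: "P \<in> bounded_ops UNIV" and idem: "\<And>x. P (P x) = P x"
  shows "closed_csubspace (range P)" "closed_csubspace {x. P x = 0}"
    "direct_sum (range P) {x. P x = 0}"
proof -
  note PD = bounded_opsD[OF P]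
  \<comment> \<open>Idempotence turns the range into a set of fixed points, which is visibly
    closed.\<close>
  have eq: "range P = {x. P x = x}" using idem by (auto intro: range_eqI[OF sym])
  show "closed_csubspace (range P)"
    unfolding eq by (intro closed_csubspace_eq_set P bounded_ops_id)
  show "closed_csubspace {x. P x = 0}"
    by (intro closed_csubspace_eq_set P bounded_ops_zero)
  have "\<exists>y z. x = y + z \<and> P y = y \<and> P z = 0" for x
    by (intro exI[of _ "P x"] exI[of _ "x - P x"]) (simp add: PD idem)
  then show "direct_sum (range P) {x. P x = 0}"
    unfolding eq by (auto simp: direct_sum_def PD)
qed

lemma projection_of_topologically_complemented:
  assumes "topologically_complemented M"
  obtains P where "P \<in> bounded_ops UNIV" "\<And>x. P x \<in> M" "\<And>x. x \<in> M \<Longrightarrow> P x = x"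
  using assms projection_of_direct_sum unfolding topologically_complemented_def by metis

lemma topologically_complementedI:
  assumes "P \<in> bounded_ops UNIV" "\<And>x. P x \<in> M" "\<And>x. x \<in> M \<Longrightarrow> P x = x"
  shows "topologically_complemented M"
proof -
  have "range P = M" using assms(2,3) by (auto intro: range_eqI[OF sym])
  then show ?thesis
    using direct_sum_of_projection[OF assms(1)] assms(2,3)
    unfolding topologically_complemented_def by auto
qed


section \<open>Reducing pairs from commuting projections\<close>

lemma bounded_ops_0: "0 \<in> M \<Longrightarrow> A \<in> bounded_ops M \<Longrightarrow> A 0 = 0"
  unfolding bounded_ops_def by fastforce

lemma nilpotent_onI:
  assumes "A \<in> bounded_ops M" "\<And>x. x \<in> M \<Longrightarrow> (A ^^ n) x = 0"
  shows "nilpotent_on M A"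
proof -
  have mem: "(A ^^ n) x \<in> M" if "x \<in> M" for x
    using assms(1) that by (induction n) (auto simp: bounded_ops_def)
  \<comment> \<open>The exponent is raised by one because \<open>nilpotent_on\<close> asks for a
    positive one, while \<open>n\<close> may be zero.\<close>
  have "(A ^^ Suc n) x = 0" if "x \<in> M" for x
    using bounded_ops_0[OF _ assms(1)] mem[OF that] assms(2)[OF that] by simp
  then show ?thesis using assms(1) by (auto simp: nilpotent_on_def intro!: exI[of _ "Suc n"])
qed

lemma funpow_image_subset: "f ` M \<subseteq> M \<Longrightarrow> x \<in> M \<Longrightarrow> (f ^^ n) x \<in> M"
  by (induction n) auto

text \<open>Common exit of the implications into (v): range and kernel of \<open>P\<close> form the
  reducing pair. The operator \<open>B\<close> lives on the whole space but has to invert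
  \<open>T\<close> only on the range of \<open>P\<close>.\<close>

lemma reduce_of_commuting_projection:
  assumes T: "T \<in> bounded_ops UNIV" and P: "P \<in> bounded_ops UNIV"
    and idem: "\<And>x. P (P x) = P x" and comm: "\<And>x. T (P x) = P (T x)"
    and B: "B \<in> bounded_ops UNIV" "\<And>x. P x = x \<Longrightarrow> P (B x) = B x" "\<And>x. P x = x \<Longrightarrow> T (B x) = x"
    and nil: "\<And>x. P x = 0 \<Longrightarrow> (T ^^ n) x = 0"
  shows "\<exists>M N. reduce M N T \<and> right_invertible_on M T \<and> nilpotent_on N T"
proof (intro exI conjI)
  have eq: "range P = {x. P x = x}" using idem by (auto intro: range_eqI[OF sym])
  have inv: "T ` range P \<subseteq> range P" "T ` {x. P x = 0} \<subseteq> {x. P x = 0}"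
    unfolding eq using bounded_opsD(5)[OF T] by (auto simp: comm[symmetric])
  show "reduce (range P) {x. P x = 0} T"
    unfolding reduce_def using direct_sum_of_projection[OF P idem] inv by blast
  have "B ` range P \<subseteq> range P" unfolding eq using B(2) by auto
  then show "right_invertible_on (range P) T"
    unfolding right_invertible_on_def
    using bounded_ops_restrict[OF T inv(1)] bounded_ops_restrict[OF B(1)] B(3) eq by auto
  show "nilpotent_on {x. P x = 0} T"
    by (rule nilpotent_onI[OF bounded_ops_restrict[OF T inv(2)] nil]) auto
qed

section \<open>From a complemented kernel on a stable range to a reduction\<close>

lemma reduce_of_complemented_kernel_on_stable_range:
  assumes T: "T \<in> bounded_ops UNIV" and stable: "range (T ^^ j) = range (T ^^ (j + 1))"
    and compl: "topologically_complemented (range (T ^^ j) \<inter> null_space T)"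
  shows "\<exists>M N. reduce M N T \<and> right_invertible_on M T \<and> nilpotent_on N T"
proof -
  define R where "R = range (T ^^ j)"
  note Tj = bounded_ops_funpow[OF T, of j]
  note TD = bounded_opsD[OF T] and TjD = bounded_opsD[OF Tj]
  have R: "complex_vector.subspace R" unfolding R_def by (rule csubspace_range[OF Tj])
  obtain Q where Q: "Q \<in> bounded_ops UNIV" and Q_mem: "\<And>x. Q x \<in> R \<inter> null_space T"
    and Q_id: "\<And>x. x \<in> R \<inter> null_space T \<Longrightarrow> Q x = x"
    using projection_of_topologically_complemented[OF compl] unfolding R_def by blast
  note QD = bounded_opsD[OF Q]
  have QR: "Q x \<in> R" and TQ: "T (Q x) = 0" and QQ: "Q (Q x) = Q x" for x
    using Q_mem[of x] Q_id[of "Q x"] by (auto simp: null_space_def)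
  \<comment> \<open>The difference lies in \<open>R \<inter> null_space T\<close>, where
    \<open>Q\<close> is the identity, yet \<open>Q\<close> annihilates it.\<close>
  have uniq: "v = w" if "v \<in> R" "w \<in> R" "Q v = Q w" "T v = T w" for v w
  proof -
    have "v - w \<in> R \<inter> null_space T"
      using that complex_vector.subspace_diff[OF R] by (auto simp: null_space_def TD)
    from Q_id[OF this] show ?thesis using that by (simp add: QD)
  qed
  \<comment> \<open>Stability of the range gives a preimage of \<open>y\<close> in \<open>R\<close>;
    subtracting its image under \<open>Q\<close> changes neither membership in \<open>R\<close> nor
    the value of \<open>T\<close>.\<close>
  have "\<exists>v. v \<in> R \<and> Q v = 0 \<and> T v = y" if "y \<in> R" for y
  proof -
    obtain z where "y = T ((T ^^ j) z)" using \<open>y \<in> R\<close> stable by (auto simp: R_def)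
    then have "(T ^^ j) z - Q ((T ^^ j) z) \<in> R \<and> Q ((T ^^ j) z - Q ((T ^^ j) z)) = 0
        \<and> T ((T ^^ j) z - Q ((T ^^ j) z)) = y"
      using complex_vector.subspace_diff[OF R _ QR] by (auto simp: R_def QD QQ TD TQ)
    then show ?thesis by blast
  qed
  then obtain V where V: "\<And>y. y \<in> R \<Longrightarrow> V y \<in> R" "\<And>y. y \<in> R \<Longrightarrow> Q (V y) = 0"
    "\<And>y. y \<in> R \<Longrightarrow> T (V y) = y"
    by metis
  have TR: "T x \<in> R" if "x \<in> R" for x
    using that unfolding R_def by (auto simp: funpow_swap1)
  have VT: "V (T x) = x - Q x" if "x \<in> R" for x
    using that
    by (intro uniq[of "V (T x)"] V TR complex_vector.subspace_diff[OF R] QR)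
      (simp_all add: V TR QD QQ TD TQ)
  have VA: "(\<lambda>x. V (A x)) \<in> bounded_ops UNIV" if A: "A \<in> bounded_ops UNIV" "\<And>x. A x \<in> R" for A
  proof (rule bounded_ops_of_closed_relation[OF _ _ _ _ Tj])
    \<comment> \<open>The relation mentions neither \<open>V\<close> nor membership in
      \<open>R\<close>, only equations between bounded operators, so it is closed even if
      \<open>R\<close> is not. The preimage \<open>u\<close> is not unique, but
      \<open>(T ^^ j) u\<close> is.\<close>
    let ?H = "{p. Q ((T ^^ j) (snd p)) = 0} \<inter> {p. T ((T ^^ j) (snd p)) = A (fst p)}"
    note AD = bounded_opsD[OF A(1)]
    show "closed ?H"
      by (intro closed_Int closed_Collect_eq continuous_intros
          bounded_linear.continuous_on[OF QD(1)] bounded_linear.continuous_on[OF TjD(1)]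
          bounded_linear.continuous_on[OF TD(1)] bounded_linear.continuous_on[OF AD(1)])
    show "(x + x', y + y') \<in> ?H" if "(x, y) \<in> ?H" "(x', y') \<in> ?H" for x x' y y'
      using that by (simp add: QD TD TjD AD)
    show "(c *C x, c *C y) \<in> ?H" if "(x, y) \<in> ?H" for x y c
      using that by (simp add: QD TD TjD AD)
    show "\<exists>y. (x, y) \<in> ?H" for x
    proof -
      obtain u where "V (A x) = (T ^^ j) u" using V(1)[OF A(2)[of x]] by (auto simp: R_def)
      then have "Q ((T ^^ j) u) = 0" "T ((T ^^ j) u) = A x"
        using V(2,3)[OF A(2)[of x]] by simp_all
      then show ?thesis by (intro exI[of _ u]) simp
    qed
    show "V (A x) = (T ^^ j) y" if "(x, y) \<in> ?H" for x y
      using that V[OF A(2)[of x]] by (intro uniq[of "V (A x)"]) (auto simp: R_def)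
  qed
  \<comment> \<open>\<open>G\<close> plays the role of \<open>P T\<^sup>n\<close>, which is known for \<open>n = j\<close>; descend to \<open>n = 0\<close>.\<close>
  have "\<exists>G \<in> bounded_ops UNIV. (\<forall>x. G x \<in> R) \<and> (\<forall>x\<in>R. G x = (T ^^ n) x)
      \<and> (\<forall>x. Q (G x) = Q ((T ^^ n) x)) \<and> (\<forall>x. T (G x) = G (T x))" if "n \<le> j" for n
    using that
  proof (induction n rule: inc_induct)
    case base
    show ?case using Tj by (intro bexI[of _ "T ^^ j"]) (auto simp: R_def funpow_swap1)
  next
    case (step n)
    then obtain G where G: "G \<in> bounded_ops UNIV" "\<And>x. G x \<in> R"
      "\<And>x. x \<in> R \<Longrightarrow> G x = T ((T ^^ n) x)" "\<And>x. Q (G x) = Q (T ((T ^^ n) x))"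
      "\<And>x. T (G x) = G (T x)"
      by auto
    \<comment> \<open>On \<open>R\<close> the term \<open>V (G x)\<close> equals
      \<open>(T ^^ n) x\<close> minus its image under \<open>Q\<close>; the first summand restores
      that kernel component.\<close>
    define G' where "G' x = Q ((T ^^ n) x) + V (G x)" for x
    have TG': "T (G' x) = G x" for x by (simp add: G'_def TD TQ V G)
    \<comment> \<open>Here the invariant \<open>Q (G x) = Q (T ((T ^^ n) x))\<close> cancels the
      defect of \<open>V\<close> as a left inverse. Together with \<open>TG'\<close> this makes
      \<open>G'\<close> commute with \<open>T\<close>.\<close>
    have "G' (T x) = G x" for x
    proof -
      have "V (G (T x)) = G x - Q (G x)" using VT[OF G(2)] G(5) by metis
      then show ?thesis by (simp add: G'_def G(4) funpow_swap1)
    qed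
    moreover have "G' x = (T ^^ n) x" if "x \<in> R" for x
    proof -
      have "(T ^^ n) x \<in> R" using that TR by (intro funpow_image_subset) auto
      then show ?thesis using G(3)[OF that] VT by (simp add: G'_def)
    qed
    moreover have "G' \<in> bounded_ops UNIV"
      unfolding G'_def
      by (intro bounded_ops_add bounded_ops_comp[OF Q] bounded_ops_funpow[OF T] VA G)
    ultimately show ?case
      using TG' by (intro bexI[of _ G'])
        (auto simp: G'_def QD QQ V G QR complex_vector.subspace_add[OF R])
  qed
  from this[of 0] obtain P where P: "P \<in> bounded_ops UNIV" "\<And>x. P x \<in> R"
    "\<And>x. x \<in> R \<Longrightarrow> P x = x" "\<And>x. T (P x) = P (T x)"
    by auto
  have PT: "P ((T ^^ n) x) = (T ^^ n) (P x)" for n x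
    by (induction n) (simp_all add: P(4)[symmetric])
  have P_fix: "x \<in> R" if "P x = x" for x using P(2)[of x] that by simp
  show ?thesis
  proof (rule reduce_of_commuting_projection[OF T P(1) _ P(4)])
    show "(\<lambda>x. V (P x)) \<in> bounded_ops UNIV" by (rule VA[OF P(1,2)])
    \<comment> \<open>\<open>(T ^^ j) x\<close> lies in \<open>R\<close>, so \<open>P\<close> fixes
      it; moving \<open>P\<close> past the power leaves \<open>(T ^^ j) (P x)\<close>, which is
      zero.\<close>
    show "(T ^^ j) x = 0" if "P x = 0" for x
      using P(3)[of "(T ^^ j) x"] PT[of j x] that by (simp add: R_def TjD)
  qed (auto simp: P V dest: P_fix)
qed

section \<open>Consequences of a reduction\<close>

text \<open>The power kills \<open>N\<close> and maps \<open>M\<close> onto itself, as iterating the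
  right inverse shows. Hence the abstract \<open>M\<close> of (v) is the concrete range required in
  (iv), and that range is closed.\<close>

lemma range_power_of_reduce:
  assumes T: "T \<in> bounded_ops UNIV" and red: "reduce M N T"
    and surj: "right_invertible_on M T" and nil: "\<And>x. x \<in> N \<Longrightarrow> (T ^^ n) x = 0"
  shows "range (T ^^ n) = M"
proof -
  note TnD = bounded_opsD[OF bounded_ops_funpow[OF T, of n]]
  have TM: "T ` M \<subseteq> M" and "direct_sum M N"
    using red by (simp_all add: reduce_def)
  then have sum: "{x + y |x y. x \<in> M \<and> y \<in> N} = UNIV"
    unfolding direct_sum_def by (elim conjE)
  obtain B where "B \<in> bounded_ops M" and TB: "\<And>x. x \<in> M \<Longrightarrow> T (B x) = x"
    using surj by (auto simp: right_invertible_on_def)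
  then have BM: "\<And>x. x \<in> M \<Longrightarrow> B x \<in> M"
    by (auto simp: bounded_ops_def)
  have "(T ^^ n) ((B ^^ n) x) = x \<and> (B ^^ n) x \<in> M" if "x \<in> M" for x
    using that by (induction n arbitrary: x) (auto simp: TB BM funpow_swap1)
  then have "M \<subseteq> range (T ^^ n)" by (metis rangeI subsetI)
  moreover have "(T ^^ n) z \<in> M" for z
  proof -
    have "z \<in> {x + y |x y. x \<in> M \<and> y \<in> N}" by (simp only: sum UNIV_I)
    then obtain x y where "x \<in> M" "y \<in> N" "z = x + y" by blast
    then show ?thesis using funpow_image_subset[OF TM] by (simp add: TnD nil)
  qed
  ultimately show ?thesis by blast
qed


text \<open>Translates a reduction into operators on the whole space: \<open>P\<close> projects onto
  \<open>M\<close> along \<open>N\<close>, and \<open>B\<close> is the right inverse on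
  \<open>M\<close> extended by zero on \<open>N\<close>.\<close>

lemma commuting_projection_of_reduce:
  assumes T: "T \<in> bounded_ops UNIV" and red: "reduce M N T"
    and surj: "right_invertible_on M T" and nil: "nilpotent_on N T"
  obtains P B n where "P \<in> bounded_ops UNIV" "\<And>x. P (P x) = P x" "\<And>x. T (P x) = P (T x)"
    "B \<in> bounded_ops UNIV" "\<And>x. P (B x) = B x" "\<And>x. T (B x) = P x"
    "n \<ge> 1" "\<And>x. (T ^^ n) (x - P x) = 0"
proof -
  obtain P where P: "P \<in> bounded_ops UNIV" "\<And>x. P x \<in> M" "\<And>x. x - P x \<in> N"
    "\<And>x. x \<in> M \<Longrightarrow> P x = x" "\<And>x. x \<in> N \<Longrightarrow> P x = 0"
    using red projection_of_direct_sum[of M N] unfolding reduce_def by metis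
  note PD = bounded_opsD[OF P(1)] and TD = bounded_opsD[OF T]
  have inv: "\<And>x. x \<in> M \<Longrightarrow> T x \<in> M" "\<And>x. x \<in> N \<Longrightarrow> T x \<in> N"
    using red by (auto simp: reduce_def)
  have comm: "T (P x) = P (T x)" for x
  proof -
    \<comment> \<open>Invariance of \<open>N\<close> makes the second summand vanish, and invariance
      of \<open>M\<close> lets \<open>P\<close> fix the argument of the first.\<close>
    have "P (T x) = P (T (P x)) + P (T (x - P x))" by (simp add: PD TD)
    then show ?thesis by (simp add: P inv)
  qed
  obtain B where B: "B \<in> bounded_ops M" "\<And>x. x \<in> M \<Longrightarrow> T (B x) = x"
    using surj by (auto simp: right_invertible_on_def)
  have BM: "B x \<in> M" if "x \<in> M" for x using B(1) that by (auto simp: bounded_ops_def)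
  obtain n where n: "n \<ge> 1" "\<And>x. x \<in> N \<Longrightarrow> (T ^^ n) x = 0"
    using nil by (auto simp: nilpotent_on_def)
  show ?thesis
  proof (rule that[of P "\<lambda>x. B (P x)" n])
    show "(\<lambda>x. B (P x)) \<in> bounded_ops UNIV"
      using P by (intro bounded_ops_comp_on[OF B(1)]) auto
  qed (use P B BM n comm in auto)
qed

section \<open>Generalized inverses and nilpotent projections\<close>

text \<open>The projection is \<open>T S\<close>: the first identity makes it commute with
  \<open>T\<close>, and with the second it is idempotent and fixes the range of \<open>S\<close>. So
  \<open>S\<close> itself inverts \<open>T\<close> on the range of \<open>T S\<close>, and the third
  identity gives nilpotency on the kernel.\<close>

lemma reduce_of_right_generalized_inverse:
  assumes T: "T \<in> bounded_ops UNIV" and S: "S \<in> bounded_ops UNIV"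
    and comm: "\<And>x. T (S (T x)) = T (T (S x))" and TSS: "\<And>x. T (S (S x)) = S x"
    and power: "\<And>x. (T ^^ (j + 1)) (S x) = (T ^^ j) x"
  shows "\<exists>M N. reduce M N T \<and> right_invertible_on M T \<and> nilpotent_on N T"
proof (rule reduce_of_commuting_projection[OF T])
  show "(\<lambda>x. T (S x)) \<in> bounded_ops UNIV" by (rule bounded_ops_comp[OF T S])
  show "(T ^^ j) x = 0" if "T (S x) = 0" for x
    using power[of x] that bounded_opsD(5)[OF bounded_ops_funpow[OF T]] by (simp add: funpow_swap1)
qed (use S in \<open>auto simp: comm TSS\<close>)

text \<open>The witness is the right inverse on \<open>M\<close> extended by zero on
  \<open>N\<close>, with the nilpotency exponent on \<open>N\<close> as \<open>j\<close>.\<close>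

lemma right_generalized_inverse_of_reduce:
  assumes T: "T \<in> bounded_ops UNIV" and "reduce M N T" "right_invertible_on M T" "nilpotent_on N T"
  shows "\<exists>S\<in>bounded_ops UNIV. \<exists>j. T \<circ> S \<circ> T = (T ^^ 2) \<circ> S \<and> T \<circ> (S ^^ 2) = S
    \<and> (T ^^ (j + 1)) \<circ> S = T ^^ j"
  using assms
proof (rule commuting_projection_of_reduce)
  fix P B n
  assume *: "B \<in> bounded_ops UNIV" "\<And>x. T (P x) = P (T x)" "\<And>x. P (B x) = B x"
    "\<And>x. T (B x) = P x" "\<And>x. (T ^^ n) (x - P x) = 0"
  show ?thesis
  proof (intro bexI[OF _ *(1)] exI[of _ n] conjI ext)
    show "((T ^^ (n + 1)) \<circ> B) x = (T ^^ n) x" for x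
      using *(5)[of x] bounded_opsD(3)[OF bounded_ops_funpow[OF T]] by (simp add: funpow_swap1 *)
  qed (simp_all add: numeral_2_eq_2 *)
qed

text \<open>The witness is the finite geometric series \<open>C = (\<Sum>k<n. (- T)\<^sup>k)\<close>.\<close>

lemma truncated_neumann_series:
  assumes T: "T \<in> bounded_ops UNIV"
  obtains C where "C \<in> bounded_ops UNIV"
    "\<And>x. T (C x) + C x = x - ((\<lambda>x. - T x) ^^ n) x"
    "\<And>P x. P \<in> bounded_ops UNIV \<Longrightarrow> (\<And>x. T (P x) = P (T x)) \<Longrightarrow> P (C x) = C (P x)"
proof -
  note TD = bounded_opsD[OF T]
  have "\<exists>C. C \<in> bounded_ops UNIV \<and> (\<forall>x. T (C x) + C x = x - ((\<lambda>x. - T x) ^^ n) x)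
    \<and> (\<forall>P x. P \<in> bounded_ops UNIV \<longrightarrow> (\<forall>x. T (P x) = P (T x)) \<longrightarrow> P (C x) = C (P x))"
  proof (induction n)
    case 0
    show ?case
      using bounded_ops_zero
      by (intro exI[of _ "\<lambda>x. 0"]) (auto simp: TD dest: bounded_opsD(5))
  next
    case (Suc n)
    then obtain C where C: "C \<in> bounded_ops UNIV"
      "\<And>x. T (C x) + C x = x - ((\<lambda>x. - T x) ^^ n) x"
      "\<And>P x. P \<in> bounded_ops UNIV \<Longrightarrow> (\<forall>x. T (P x) = P (T x)) \<Longrightarrow> P (C x) = C (P x)"
      by blast
    show ?case
    \<comment> \<open>Horner's scheme: the next partial sum is the identity minus \<open>T\<close>
      applied to the current one.\<close>
    proof (intro exI[of _ "\<lambda>x. x - T (C x)"] conjI allI impI)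
      show "(\<lambda>x. x - T (C x)) \<in> bounded_ops UNIV"
        by (intro bounded_ops_diff bounded_ops_id bounded_ops_comp[OF T C(1)])
      show "T (x - T (C x)) + (x - T (C x)) = x - ((\<lambda>x. - T x) ^^ Suc n) x" for x
        using arg_cong[OF C(2)[of x], of T] by (simp add: TD algebra_simps)
      show "P (x - T (C x)) = P x - T (C (P x))"
        if "P \<in> bounded_ops UNIV" "\<forall>x. T (P x) = P (T x)" for P x
        using C(3)[OF that] bounded_opsD[OF that(1)] that(2) by metis
    qed
  qed
  then show ?thesis using that by blast
qed

text \<open>The projection \<open>E\<close> is onto the nilpotent summand. There
  \<open>T + E\<close> is \<open>T + I\<close>, inverted by the finite geometric series
  \<open>C\<close>; on the other summand it is \<open>T\<close>, with right inverse
  \<open>B\<close>. Together \<open>B + C E\<close> is a right inverse.\<close>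

lemma nilpotent_projection_of_reduce:
  assumes T: "T \<in> bounded_ops UNIV" and "reduce M N T" "right_invertible_on M T" "nilpotent_on N T"
  shows "\<exists>P. projection P \<and> T \<circ> P = P \<circ> T
      \<and> right_invertible_on UNIV (\<lambda>x. T x + P x) \<and> nilpotent_on UNIV (T \<circ> P)"
  using assms
proof (rule commuting_projection_of_reduce)
  fix P B n
  assume P: "P \<in> bounded_ops UNIV" "\<And>x. P (P x) = P x" "\<And>x. T (P x) = P (T x)"
    and B: "B \<in> bounded_ops UNIV" "\<And>x. P (B x) = B x" "\<And>x. T (B x) = P x"
    and n: "n \<ge> 1" "\<And>x. (T ^^ n) (x - P x) = 0"
  note TD = bounded_opsD[OF T] and PD = bounded_opsD[OF P(1)]
  define E where "E x = x - P x" for x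
  have E: "E \<in> bounded_ops UNIV"
    unfolding E_def by (intro bounded_ops_diff bounded_ops_id P)
  have TE: "T (E x) = E (T x)" and EE: "E (E x) = E x" and EB: "E (B x) = 0" for x
    by (simp_all add: E_def TD PD P B)
  obtain C where C: "C \<in> bounded_ops UNIV"
    "\<And>x. T (C x) + C x = x - ((\<lambda>x. - T x) ^^ n) x"
    "\<And>P x. P \<in> bounded_ops UNIV \<Longrightarrow> (\<And>x. T (P x) = P (T x)) \<Longrightarrow> P (C x) = C (P x)"
    using truncated_neumann_series[OF T] by metis
  have neg: "((\<lambda>x. - T x) ^^ m) (E x) = 0" if "(T ^^ m) (E x) = 0" for m x
  proof -
    have "((\<lambda>x. - T x) ^^ m) y = (T ^^ m) y \<or> ((\<lambda>x. - T x) ^^ m) y = - (T ^^ m) y" for y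
      by (induction m) (auto simp: TD)
    then show ?thesis using that by (metis minus_zero)
  qed
  show ?thesis
  proof (intro exI[of _ E] conjI)
    show "projection E" using E EE by (auto simp: projection_def)
    show "T \<circ> E = E \<circ> T" using TE by auto
    have "T (B x + C (E x)) + E (B x + C (E x)) = x" for x
    proof -
      have "E (C (E x)) = C (E x)" using C(3)[OF E TE] EE by simp
      then have "T (B x + C (E x)) + E (B x + C (E x)) = P x + (T (C (E x)) + C (E x))"
        by (simp add: TD bounded_opsD(2)[OF E] EB B)
      also have "\<dots> = x"
        using n(2)[of x] neg[of n x] by (simp add: C(2)) (simp add: E_def)
      finally show ?thesis .
    qed
    then show "right_invertible_on UNIV (\<lambda>x. T x + E x)"
      unfolding right_invertible_on_def
      by (auto intro!: bounded_ops_add T E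
          bexI[of _ "\<lambda>x. B x + C (E x)", OF _ bounded_ops_add[OF B(1) bounded_ops_comp[OF C(1) E]]])
    have "E ((T ^^ m) x) = (T ^^ m) (E x)" for m x
      by (induction m) (simp_all flip: TE)
    \<comment> \<open>The exponent starts at one: at zero the left side would be \<open>x\<close>
      and the right side \<open>E x\<close>.\<close>
    then have "((T \<circ> E) ^^ Suc m) x = (T ^^ Suc m) (E x)" for m x
      by (induction m) (simp_all add: EE flip: TE)
    then have "((T \<circ> E) ^^ n) x = 0" for x
      using n by (cases n) (auto simp: E_def simp del: funpow.simps)
    then show "nilpotent_on UNIV (T \<circ> E)"
      using n bounded_ops_comp[OF T E] unfolding nilpotent_on_def comp_def by blast
  qed
qed

text \<open>The complementary projection \<open>I - P\<close> does the work: on the kernel of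
  \<open>P\<close> a right inverse of \<open>T\<close> is \<open>(I - P) B\<close>, while on the
  range of \<open>P\<close> the powers of \<open>T\<close> and \<open>T P\<close> agree.\<close>

lemma reduce_of_nilpotent_projection:
  assumes T: "T \<in> bounded_ops UNIV" and P: "projection P" and comm: "\<And>x. T (P x) = P (T x)"
    and inv: "right_invertible_on UNIV (\<lambda>x. T x + P x)" and nil: "nilpotent_on UNIV (T \<circ> P)"
  shows "\<exists>M N. reduce M N T \<and> right_invertible_on M T \<and> nilpotent_on N T"
proof -
  have Pb: "P \<in> bounded_ops UNIV" and idem: "P (P x) = P x" for x
    using P by (auto simp: projection_def fun_eq_iff)
  note TD = bounded_opsD[OF T] and PD = bounded_opsD[OF Pb]
  obtain B where B: "B \<in> bounded_ops UNIV" "\<And>x. T (B x) + P (B x) = x"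
    using inv by (auto simp: right_invertible_on_def)
  obtain n where n: "\<And>x. ((T \<circ> P) ^^ n) x = 0" using nil by (auto simp: nilpotent_on_def)
  show ?thesis
  proof (rule reduce_of_commuting_projection[OF T])
    show "(\<lambda>x. x - P x) \<in> bounded_ops UNIV" by (intro bounded_ops_diff bounded_ops_id Pb)
    show "(\<lambda>x. B x - P (B x)) \<in> bounded_ops UNIV"
      by (intro bounded_ops_diff bounded_ops_comp[OF Pb] B)
    show "T (B x - P (B x)) = x" if "x - P x = x" for x
    proof -
      \<comment> \<open>Obtained by applying \<open>P\<close> to
        \<open>T (B x) + P (B x) = x\<close>, since \<open>P x = 0\<close>. Thus subtracting
        \<open>T (P (B x))\<close> amounts to adding \<open>P (B x)\<close>.\<close>
      have "T (P (B x)) + P (B x) = 0"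
        using arg_cong[OF B(2)[of x], of P] that by (simp add: PD idem comm)
      then have "T (B x) - T (P (B x)) = T (B x) + P (B x)"
        by (metis add_eq_0_iff diff_conv_add_uminus minus_minus)
      then show ?thesis using B(2)[of x] by (simp add: TD)
    qed
    show "(T ^^ n) x = 0" if "x - P x = 0" for x
    proof -
      have "((T \<circ> P) ^^ m) x = (T ^^ m) x \<and> P ((T ^^ m) x) = (T ^^ m) x" for m
        using that by (induction m) (auto simp: comm[symmetric])
      then show ?thesis using n by metis
    qed
  qed (simp_all add: PD TD idem comm)
qed

section \<open>Descent and stable ranges\<close>

lemma descent_le:
  "range (T ^^ q) = range (T ^^ (q + 1)) \<Longrightarrow> descent T \<le> enat q"
  unfolding descent_def by (rule Inf_lower) blast

text \<open>A finite infimum in \<open>enat\<close> comes from a nonempty set and is attained as its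
  least element.\<close>

lemma range_power_descent:
  assumes "descent T = enat d"
  shows "range (T ^^ d) = range (T ^^ (d + 1))"
proof -
  let ?D = "{enat q |q. range (T ^^ q) = range (T ^^ (q + 1))}"
  have "?D \<noteq> {}" using assms unfolding descent_def Inf_enat_def by (metis enat.distinct(1))
  then have "Inf ?D \<in> ?D" unfolding Inf_enat_def by (metis (no_types, lifting) LeastI_ex ex_in_conv)
  then have "enat d \<in> ?D" using assms unfolding descent_def by metis
  then show ?thesis by blast
qed

lemma range_power_stable:
  fixes T :: "'a \<Rightarrow> 'a"
  assumes "range (T ^^ d) = range (T ^^ (d + 1))" "d \<le> n"
  shows "range (T ^^ n) = range (T ^^ d)"
proof -
  have im: "range (T ^^ (m + 1)) = T ` range (T ^^ m)" for m by (simp add: image_comp)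
  show ?thesis using assms(2)
  proof (induction n rule: dec_induct)
    case (step n)
    then show ?case using im[of n] im[of d] assms(1) by simp
  qed simp
qed

text \<open>With a right inverse \<open>B\<close> of \<open>T\<close> on the range \<open>R\<close>,
  the operator \<open>I - B T\<close> projects \<open>R\<close> onto its intersection with the
  kernel; preceded by a bounded projection onto \<open>R\<close>, it projects the whole
  space.\<close>

lemma complemented_kernel_of_complemented_range:
  assumes T: "T \<in> bounded_ops UNIV" and compl: "topologically_complemented (range (T ^^ j))"
    and surj: "right_invertible_on (range (T ^^ j)) T"
  shows "descent T < \<infinity>
    \<and> topologically_complemented (range (T ^^ the_enat (descent T)) \<inter> null_space T)"
proof -
  let ?R = "range (T ^^ j)"
  note TD = bounded_opsD[OF T]
  obtain B where B: "B \<in> bounded_ops ?R" "\<And>x. x \<in> ?R \<Longrightarrow> T (B x) = x"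
    using surj by (auto simp: right_invertible_on_def)
  have TR: "T x \<in> ?R" if "x \<in> ?R" for x using that by (auto simp: funpow_swap1)
  have BR: "B x \<in> ?R" if "x \<in> ?R" for x using B(1) that unfolding bounded_ops_def by blast
  have stable: "?R = range (T ^^ (j + 1))"
  proof
    show "?R \<subseteq> range (T ^^ (j + 1))"
    proof
      fix x assume "x \<in> ?R"
      then obtain z where "B x = (T ^^ j) z" using BR by blast
      with B(2)[OF \<open>x \<in> ?R\<close>] have "x = (T ^^ (j + 1)) z" by simp
      then show "x \<in> range (T ^^ (j + 1))" by blast
    qed
  qed (auto simp: funpow_swap1)
  then obtain d where d: "descent T = enat d" "d \<le> j"
    using descent_le[of j T] by (metis enat_ile enat_ord_simps(1))
  \<comment> \<open>The given \<open>j\<close> may exceed the descent, but the ranges no longer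
    change from \<open>d\<close> on.\<close>
  then have Rd: "range (T ^^ d) = ?R"
    using range_power_stable[OF range_power_descent] by metis
  obtain P where P: "P \<in> bounded_ops UNIV" "\<And>x. P x \<in> ?R" "\<And>x. x \<in> ?R \<Longrightarrow> P x = x"
    using projection_of_topologically_complemented[OF compl] by blast
  have "topologically_complemented (?R \<inter> null_space T)"
  proof (rule topologically_complementedI)
    have "(\<lambda>x. B (T (P x))) \<in> bounded_ops UNIV"
      using TR[OF P(2)] by (intro bounded_ops_comp_on[OF B(1)] bounded_ops_comp[OF T P(1)]) auto
    then show "(\<lambda>x. P x - B (T (P x))) \<in> bounded_ops UNIV"
      by (intro bounded_ops_diff P)
    show "P x - B (T (P x)) \<in> ?R \<inter> null_space T" for x
      using complex_vector.subspace_diff[OF csubspace_range[OF bounded_ops_funpow[OF T]] P(2) BR[OF TR[OF P(2)]]]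
      by (simp add: null_space_def TD B(2)[OF TR[OF P(2)]])
    have "0 \<in> ?R"
      by (intro complex_vector.subspace_0 csubspace_range bounded_ops_funpow T)
    then have "B 0 = 0" using B(1) by (rule bounded_ops_0)
    then show "P x - B (T (P x)) = x" if "x \<in> ?R \<inter> null_space T" for x
      using that P(3)[of x] by (simp add: null_space_def)
  qed
  then show ?thesis using d Rd by simp
qed

section \<open>Equivalence of the six conditions\<close>

text \<open>Condition (v) is the hub: (i) and (ii) are each equivalent to it, and the others are
  joined to it by the cycle (v), (iv), (vi), (iii), (v).\<close>

theorem theorem3p9:
  fixes T :: "'a::complex_banach \<Rightarrow> 'a"
  assumes "T \<in> bounded_ops UNIV"
  shows "all_equivalent
   [\<exists>S\<in>bounded_ops UNIV. \<exists>j::nat.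
      T \<circ> S \<circ> T = (T ^^ 2) \<circ> S \<and> T \<circ> (S ^^ 2) = S \<and> (T ^^ (j + 1)) \<circ> S = T ^^ j,
    \<exists>P. projection P \<and> T \<circ> P = P \<circ> T
      \<and> right_invertible_on UNIV (\<lambda>x. T x + P x) \<and> nilpotent_on UNIV (T \<circ> P),
    descent T < \<infinity>
      \<and> topologically_complemented (range (T ^^ the_enat (descent T)) \<inter> null_space T),
    \<exists>(j::nat) N. reduce (range (T ^^ j)) N T
      \<and> right_invertible_on (range (T ^^ j)) T \<and> (\<forall>x\<in>N. (T ^^ j) x = 0),
    \<exists>M N. reduce M N T \<and> right_invertible_on M T \<and> nilpotent_on N T,
    \<exists>j::nat. topologically_complemented (range (T ^^ j))
      \<and> right_invertible_on (range (T ^^ j)) T]"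
  (is "all_equivalent [?i, ?ii, ?iii, ?iv, ?v, ?vi]")
proof -
  note T = assms
  have i_v: "?i \<Longrightarrow> ?v"
  proof -
    assume ?i
    then obtain S j where S: "S \<in> bounded_ops UNIV"
      "T \<circ> S \<circ> T = (T ^^ 2) \<circ> S" "T \<circ> (S ^^ 2) = S" "(T ^^ (j + 1)) \<circ> S = T ^^ j"
      by blast
    show ?v
    proof (rule reduce_of_right_generalized_inverse[OF T S(1)])
      show "T (S (T x)) = T (T (S x))" for x
        using fun_cong[OF S(2), of x] by (simp add: numeral_2_eq_2)
      show "T (S (S x)) = S x" for x
        using fun_cong[OF S(3), of x] by (simp add: numeral_2_eq_2)
      show "(T ^^ (j + 1)) (S x) = (T ^^ j) x" for x
        using fun_cong[OF S(4), of x] by (simp only: comp_apply)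
    qed
  qed
  have v_i: "?v \<Longrightarrow> ?i" by (elim exE conjE) (rule right_generalized_inverse_of_reduce[OF T])
  have ii_v: "?ii \<Longrightarrow> ?v"
    by (elim exE conjE, rule reduce_of_nilpotent_projection[OF T]) (simp_all add: fun_eq_iff)
  have v_ii: "?v \<Longrightarrow> ?ii" by (elim exE conjE) (rule nilpotent_projection_of_reduce[OF T])
  have v_iv: "?v \<Longrightarrow> ?iv"
  proof -
    assume ?v
    then obtain M N n where "reduce M N T" "right_invertible_on M T" "\<And>x. x \<in> N \<Longrightarrow> (T ^^ n) x = 0"
      by (auto simp: nilpotent_on_def)
    from range_power_of_reduce[OF T this] this show ?iv
      by (intro exI[of _ n] exI[of _ N] conjI ballI) simp_all
  qed
  have iv_vi: "?iv \<Longrightarrow> ?vi" by (auto simp: reduce_def topologically_complemented_def)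
  have vi_iii: "?vi \<Longrightarrow> ?iii" by (elim exE conjE) (rule complemented_kernel_of_complemented_range[OF T])
  have iii_v: "?iii \<Longrightarrow> ?v"
  proof -
    assume iii: ?iii
    then obtain d where d: "descent T = enat d" by (metis less_infinityE)
    then have "range (T ^^ d) = range (T ^^ (d + 1))" by (rule range_power_descent)
    then show ?v using iii d by (intro reduce_of_complemented_kernel_on_stable_range[OF T]) auto
  qed
  have all_eqI: "all_equivalent [a, b, c, d, e, f]"
    if "a = e" "b = e" "c = e" "d = e" "f = e" for a b c d e f
    using that by (simp add: all_equivalent_def)
  show ?thesis
  proof (rule all_eqI)
    show "?i = ?v" by (rule iffI[OF i_v v_i])
    show "?ii = ?v" by (rule iffI[OF ii_v v_ii])
    show "?iii = ?v" by (rule iffI[OF iii_v vi_iii[OF iv_vi[OF v_iv]]])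
    show "?iv = ?v" by (rule iffI[OF iii_v[OF vi_iii[OF iv_vi]] v_iv])
    show "?vi = ?v" by (rule iffI[OF iii_v[OF vi_iii] iv_vi[OF v_iv]])
  qed
qed

end
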